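(* For a space $X$, let $$\mathrm{SCD}_{\mathcal P_{\mathrm{fin}}(X)}=\left\{\mathbf F\in\mathrm{CD}_{\mathcal P_{\mathrm{fin}}(X)}:\bigcup\mathbf F\in\mathrm{CD}_X\right\}.$$ Then $$\mathsf G_1(\mathcal T_X,\mathrm{CD}_X)\rightleftarrows\mathsf G_1(\mathcal T_{\mathcal P_{\mathrm{fin}}(X)},\mathrm{SCD}_{\mathcal P_{\mathrm{fin}}(X)}).$$ Consequently, for any space $X$, $$\mathsf G_1(\mathcal T_X,\mathrm{CD}_X)\leq^+_{\mathrm{II}}\mathsf G_1(\mathcal T_{\mathcal P_{\mathrm{fin}}(X)},\mathrm{CD}_{\mathcal P_{\mathrm{fin}}(X)})$$ and $$\vec{\mathsf G}_1(\mathcal T_X,\mathrm{CD}^\ast_X)\leq^+_{\mathrm{II}}\vec{\mathsf G}_1(\mathcal T_{\mathcal P_{\mathrm{fin}}(X)},\mathrm{CD}^\ast_{\mathcal P_{\mathrm{fin}}(X)}).$$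
   Context: $\mathbb N$ is the set of positive integers. A space is a nonempty topological space; no separation axioms are assumed. $\mathcal T_X$ is the set of nonempty open subsets of $X$. $\mathrm{CD}_X$ is the set of closed and relatively discrete subsets of $X$: those closed $A\subseteq X$ such that for every $x\in A$ there is $U\in\mathcal T_X$ with $U\cap A=\{x\}$. $\mathrm{CD}^\ast_X$ is the set of injective sequences $s:\mathbb N\to X$ with $\{s_n:n\in\mathbb N\}\in\mathrm{CD}_X$. $\mathcal P_{\mathrm{fin}}(X)$ is the set $[X]^{<\aleph_0}$ of nonempty finite subsets of $X$ with the Vietoris topology, which has as a basis the sets $[U_1,\ldots,U_n]=\{F\in[X]^{<\aleph_0}:F\subseteq\bigcup_{j=1}^nU_j\text{ and }F\cap U_j\neq\varnothing\text{ for all }1\le j\le n\}$, with $n\in\mathbb N$ and $U_1,\dots,U_n\in\mathcal T_X$. Games. For a collection $\mathcal A$ of sets and a collection $\mathcal B$, the game $\mathsf G_1(\mathcal A,\mathcal B)$ has rounds indexed by $n\in\mathbb N$; in round $n$, P1 chooses $A_n\in\mathcal A$ and P2 responds with $x_n\in A_n$. P2 wins if $\{x_n:n\in\mathbb N\}\in\mathcal B$; otherwise P1 wins. The game $\vec{\mathsf G}_1(\mathcal A,\mathcal B)$ is played the same way, but P2 wins if and only if the sequence $\langle x_n:n\in\mathbb N\rangle$ is in $\mathcal B$. Strategies. A strategy for P1 assigns to each finite sequence (possibly empty) of previous P2 moves an element of $\mathcal A$; a predetermined strategy for P1 is a function $\sigma:\mathbb N\to\mathcal A$ (depending only on the round number);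 a constant strategy for P1 always plays one fixed $A_0\in\mathcal A$. A strategy for P2 assigns to each finite sequence $\langle A_1,\dots,A_n\rangle$ of P1 moves a legal response to $A_n$; a Markov strategy for P2 assigns to each pair $(A,n)\in\mathcal A\times\mathbb N$ a legal response to $A$ (depending only on the latest P1 move and the round number). A strategy is winning if its player wins every run in which they follow it. Write $\mathrm I\uparrow\mathcal G$, $\mathrm I\uparrow_{\mathrm{pre}}\mathcal G$, $\mathrm I\uparrow_{\mathrm{cnst}}\mathcal G$ if P1 has a winning strategy, a winning predetermined strategy, a winning constant strategy, respectively, in $\mathcal G$; and $\mathrm{II}\uparrow\mathcal G$, $\mathrm{II}\uparrow_{\mathrm{mark}}\mathcal G$ if P2 has a winning strategy, a winning Markov strategy, respectively. A slashed arrow denotes negation. Comparison of games. $\mathcal G\leq^+_{\mathrm{II}}\mathcal H$ means that all of the following hold: $\mathrm{II}\uparrow_{\mathrm{mark}}\mathcal G\Rightarrow\mathrm{II}\uparrow_{\mathrm{mark}}\mathcal H$; $\mathrm{II}\uparrow\mathcal G\Rightarrow\mathrm{II}\uparrow\mathcal H$; $\mathrm I\not\uparrow\mathcal G\Rightarrow\mathrm I\not\uparrow\mathcal H$; $\mathrm I\not\uparrow_{\mathrm{pre}}\mathcal G\Rightarrow\mathrm I\not\uparrow_{\mathrm{pre}}\mathcal H$; $\mathrm I\not\uparrow_{\mathrm{cnst}}\mathcal G\Rightarrow\mathrm I\not\uparrow_{\mathrm{cnst}}\mathcal H$. $\mathcal G\rightleftarrows\mathcal H$ means $\mathcal G\leq^+_{\mathrm{II}}\mathcal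 H$ and $\mathcal H\leq^+_{\mathrm{II}}\mathcal G$. *)

theory Defs
  imports "HOL-Analysis.Analysis"
begin

section \<open>Selection games\<close>

text \<open>
  A game is given by the collection from which P1 chooses and the set of sequences of P2 moves
  with which P2 wins. Rounds are numbered from 0, so \<^typ>\<open>nat\<close> stands for the positive integers
  as the index set of rounds and of sequences.
\<close>

datatype 'm game = Game (moves: "'m set set") (payoff: "(nat \<Rightarrow> 'm) set")

definition G1 :: "'m set set \<Rightarrow> 'm set set \<Rightarrow> 'm game" where
  "G1 \<A> \<B> = Game \<A> {x. range x \<in> \<B>}"

definition vecG1 :: "'m set set \<Rightarrow> (nat \<Rightarrow> 'm) set \<Rightarrow> 'm game" where
  "vecG1 \<A> \<B> = Game \<A> \<B>"

definition is_run :: "'m game \<Rightarrow> (nat \<Rightarrow> 'm set) \<Rightarrow> (nat \<Rightarrow> 'm) \<Rightarrow> bool" where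
  "is_run G A x \<longleftrightarrow> (\<forall>n. A n \<in> moves G \<and> x n \<in> A n)"

definition I_wins :: "'m game \<Rightarrow> bool" where
  "I_wins G \<longleftrightarrow>
    (\<exists>\<sigma> :: 'm list \<Rightarrow> 'm set.
      (\<forall>xs \<in> lists (\<Union>(moves G)). \<sigma> xs \<in> moves G) \<and>
      (\<forall>A x. is_run G A x \<and> (\<forall>n. A n = \<sigma> (map x [0..<n])) \<longrightarrow> x \<notin> payoff G))"

definition I_wins_pre :: "'m game \<Rightarrow> bool" where
  "I_wins_pre G \<longleftrightarrow>
    (\<exists>\<sigma> :: nat \<Rightarrow> 'm set.
      (\<forall>n. \<sigma> n \<in> moves G) \<and>
      (\<forall>A x. is_run G A x \<and> (\<forall>n. A n = \<sigma> n) \<longrightarrow> x \<notin> payoff G))"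

definition I_wins_cnst :: "'m game \<Rightarrow> bool" where
  "I_wins_cnst G \<longleftrightarrow>
    (\<exists>A0 \<in> moves G.
      \<forall>A x. is_run G A x \<and> (\<forall>n. A n = A0) \<longrightarrow> x \<notin> payoff G)"

definition II_wins :: "'m game \<Rightarrow> bool" where
  "II_wins G \<longleftrightarrow>
    (\<exists>\<tau> :: 'm set list \<Rightarrow> 'm.
      (\<forall>As \<in> lists (moves G). As \<noteq> [] \<longrightarrow> \<tau> As \<in> last As) \<and>
      (\<forall>A x. is_run G A x \<and> (\<forall>n. x n = \<tau> (map A [0..<Suc n])) \<longrightarrow> x \<in> payoff G))"

definition II_wins_mark :: "'m game \<Rightarrow> bool" where
  "II_wins_mark G \<longleftrightarrow>
    (\<exists>\<tau> :: 'm set \<Rightarrow> nat \<Rightarrow> 'm.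
      (\<forall>A \<in> moves G. \<forall>n. \<tau> A n \<in> A) \<and>
      (\<forall>A x. is_run G A x \<and> (\<forall>n. x n = \<tau> (A n) n) \<longrightarrow> x \<in> payoff G))"

definition game_le :: "'m game \<Rightarrow> 'k game \<Rightarrow> bool" (infix "\<le>\<^sub>I\<^sub>I\<^sup>+" 50) where
  "G \<le>\<^sub>I\<^sub>I\<^sup>+ H \<longleftrightarrow>
    (II_wins_mark G \<longrightarrow> II_wins_mark H) \<and>
    (II_wins G \<longrightarrow> II_wins H) \<and>
    (\<not> I_wins G \<longrightarrow> \<not> I_wins H) \<and>
    (\<not> I_wins_pre G \<longrightarrow> \<not> I_wins_pre H) \<and>
    (\<not> I_wins_cnst G \<longrightarrow> \<not> I_wins_cnst H)"

definition game_equiv :: "'m game \<Rightarrow> 'k game \<Rightarrow> bool" (infix "\<rightleftharpoons>" 50) where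
  "G \<rightleftharpoons> H \<longleftrightarrow> G \<le>\<^sub>I\<^sub>I\<^sup>+ H \<and> H \<le>\<^sub>I\<^sub>I\<^sup>+ G"


section \<open>Closed discrete sets and the Vietoris space of finite sets\<close>

definition nonempty_opens :: "'a topology \<Rightarrow> 'a set set" where
  "nonempty_opens X = {U. openin X U \<and> U \<noteq> {}}"

definition CD :: "'a topology \<Rightarrow> 'a set set" where
  "CD X = {A. closedin X A \<and> (\<forall>x\<in>A. \<exists>U\<in>nonempty_opens X. U \<inter> A = {x})}"

definition CD_seq :: "'a topology \<Rightarrow> (nat \<Rightarrow> 'a) set" where
  "CD_seq X = {s. inj s \<and> range s \<in> CD X}"

definition fin_subsets :: "'a topology \<Rightarrow> 'a set set" where
  "fin_subsets X = {F. F \<subseteq> topspace X \<and> finite F \<and> F \<noteq> {}}"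

text \<open>
  The set \<open>[U\<^sub>1, \<dots>, U\<^sub>n]\<close> depends only on the finite nonempty family
  \<open>\<U> = {U\<^sub>1, \<dots>, U\<^sub>n}\<close>.
\<close>

definition vietoris_basic :: "'a topology \<Rightarrow> 'a set set \<Rightarrow> 'a set set" where
  "vietoris_basic X \<U> = {F \<in> fin_subsets X. F \<subseteq> \<Union>\<U> \<and> (\<forall>U\<in>\<U>. F \<inter> U \<noteq> {})}"

definition is_vietoris_basic :: "'a topology \<Rightarrow> 'a set set \<Rightarrow> bool" where
  "is_vietoris_basic X W \<longleftrightarrow>
    (\<exists>\<U>. finite \<U> \<and> \<U> \<noteq> {} \<and> \<U> \<subseteq> nonempty_opens X \<and> W = vietoris_basic X \<U>)"

definition Pfin :: "'a topology \<Rightarrow> 'a set topology" where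
  "Pfin X = topology (arbitrary union_of is_vietoris_basic X)"

lemma vietoris_basic_Int:
  assumes "is_vietoris_basic X V" "is_vietoris_basic X W"
  shows "(arbitrary union_of is_vietoris_basic X) (V \<inter> W)"
proof (cases "V \<inter> W = {}")
  case True
  then show ?thesis
    by (simp add: arbitrary_union_of_empty)
next
  case False
  obtain \<U> where U: "finite \<U>" "\<U> \<noteq> {}" "\<U> \<subseteq> nonempty_opens X" "V = vietoris_basic X \<U>"
    using assms(1) by (auto simp: is_vietoris_basic_def)
  obtain \<W> where W: "finite \<W>" "\<W> \<noteq> {}" "\<W> \<subseteq> nonempty_opens X" "W = vietoris_basic X \<W>"
    using assms(2) by (auto simp: is_vietoris_basic_def)
  define \<K> where "\<K> = (\<lambda>U. U \<inter> \<Union>\<W>) ` \<U> \<union> (\<lambda>U. U \<inter> \<Union>\<U>) ` \<W>"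
  have eq: "V \<inter> W = vietoris_basic X \<K>"
  proof (rule set_eqI)
    fix F
    have "F \<subseteq> \<Union>\<U> \<and> F \<subseteq> \<Union>\<W> \<longleftrightarrow> F \<subseteq> \<Union>\<K>"
      unfolding \<K>_def by blast
    moreover have "(\<forall>U\<in>\<U>. F \<inter> U \<noteq> {}) \<and> (\<forall>U\<in>\<W>. F \<inter> U \<noteq> {}) \<longleftrightarrow> (\<forall>U\<in>\<K>. F \<inter> U \<noteq> {})"
      if "F \<subseteq> \<Union>\<U>" "F \<subseteq> \<Union>\<W>"
    proof -
      have "F \<inter> (U \<inter> \<Union>\<W>) = F \<inter> U" "F \<inter> (U \<inter> \<Union>\<U>) = F \<inter> U" for U
        using that by auto
      then show ?thesis
        unfolding \<K>_def by (simp only: ball_Un ball_simps)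
    qed
    ultimately show "F \<in> V \<inter> W \<longleftrightarrow> F \<in> vietoris_basic X \<K>"
      unfolding U(4) W(4) vietoris_basic_def by blast
  qed
  have "{} \<notin> \<K>"
    using False unfolding eq vietoris_basic_def by auto
  moreover have "openin X U" if "U \<in> \<K>" for U
    using that U(3) W(3) unfolding \<K>_def nonempty_opens_def
    by (auto intro!: openin_Int openin_Union)
  ultimately have "\<K> \<subseteq> nonempty_opens X"
    unfolding nonempty_opens_def by auto
  moreover have "finite \<K>" "\<K> \<noteq> {}"
    using U(1,2) W(1,2) by (auto simp: \<K>_def)
  ultimately have "is_vietoris_basic X (V \<inter> W)"
    using eq unfolding is_vietoris_basic_def by blast
  then show ?thesis
    by (rule arbitrary_union_of_inc)
qed

lemma openin_Pfin: "openin (Pfin X) = arbitrary union_of is_vietoris_basic X"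
proof -
  have "istopology (arbitrary union_of is_vietoris_basic X)"
    unfolding istopology_base_alt
    by (metis (no_types, lifting) arbitrary_union_of_Int_eq vietoris_basic_Int)
  then show ?thesis
    by (simp add: Pfin_def)
qed

lemma topspace_Pfin: "topspace (Pfin X) = fin_subsets X"
proof
  show "topspace (Pfin X) \<subseteq> fin_subsets X"
    unfolding topspace_def openin_Pfin union_of_def arbitrary_def is_vietoris_basic_def
      vietoris_basic_def by blast
  show "fin_subsets X \<subseteq> topspace (Pfin X)"
  proof
    fix F assume F: "F \<in> fin_subsets X"
    then have "topspace X \<in> nonempty_opens X" and "F \<in> vietoris_basic X {topspace X}"
      by (auto simp: fin_subsets_def nonempty_opens_def vietoris_basic_def)
    moreover have "openin (Pfin X) (vietoris_basic X {topspace X})"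
      unfolding openin_Pfin
      by (rule arbitrary_union_of_inc, unfold is_vietoris_basic_def, rule exI[of _ "{topspace X}"])
        (use calculation in auto)
    ultimately show "F \<in> topspace (Pfin X)"
      using openin_subset by blast
  qed
qed

definition SCD_Pfin :: "'a topology \<Rightarrow> 'a set set set" where
  "SCD_Pfin X = {\<F> \<in> CD (Pfin X). \<Union>\<F> \<in> CD X}"

end

theory Submission
  imports Defs
begin

text \<open>
  P2 answers a Vietoris open set containing \<open>[U\<^sub>1, \<dots>, U\<^sub>k]\<close> by playing \<open>k\<close> rounds of the game on
  \<open>X\<close> against \<open>U\<^sub>1, \<dots>, U\<^sub>k\<close> and collecting the answers into one finite set. This works because any
  family of finite subsets of a closed discrete set is closed and discrete in the Vietoris
  topology. Conversely, \<open>U\<close> is translated into \<open>[U]\<close>, and P2 picks a point of the answer.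
  Constant strategies of P1 have to be treated separately, since consecutive rounds against
  different \<open>U\<^sub>i\<close> are not available: there one uses that closed discrete sets are stable under
  finite unions.
\<close>

section \<open>Reductions between games\<close>

lemma I_wins_iff:
  "I_wins G \<longleftrightarrow> (\<exists>\<sigma>. (\<forall>xs \<in> lists (\<Union>(moves G)). \<sigma> xs \<in> moves G) \<and>
    (\<forall>x. is_run G (\<lambda>n. \<sigma> (map x [0..<n])) x \<longrightarrow> x \<notin> payoff G))"
proof -
  have "(\<forall>A x. is_run G A x \<and> (\<forall>n. A n = \<sigma> (map x [0..<n])) \<longrightarrow> x \<notin> payoff G) \<longleftrightarrow>
    (\<forall>x. is_run G (\<lambda>n. \<sigma> (map x [0..<n])) x \<longrightarrow> x \<notin> payoff G)" for \<sigma>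
    unfolding fun_eq_iff[symmetric] by auto
  then show ?thesis by (simp only: I_wins_def)
qed

lemma I_wins_pre_iff:
  "I_wins_pre G \<longleftrightarrow> (\<exists>\<sigma>. (\<forall>n. \<sigma> n \<in> moves G) \<and> (\<forall>x. is_run G \<sigma> x \<longrightarrow> x \<notin> payoff G))"
  unfolding I_wins_pre_def fun_eq_iff[symmetric] by auto

lemma I_wins_cnst_iff:
  "I_wins_cnst G \<longleftrightarrow> (\<exists>A0\<in>moves G. \<forall>x. is_run G (\<lambda>_. A0) x \<longrightarrow> x \<notin> payoff G)"
  unfolding I_wins_cnst_def fun_eq_iff[symmetric] by auto

text \<open>Each round is translated on its own: \<open>\<Phi>\<close> carries a move of P1 from
  \<open>G\<close> to \<open>H\<close>, and \<open>\<psi>\<close> carries the answer of P2 back. A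
  strategy of P2 for \<open>H\<close> thus becomes one for \<open>G\<close>, and a strategy of P1
  for \<open>G\<close> becomes one for \<open>H\<close>. Since \<open>\<Phi>\<close> and
  \<open>\<psi>\<close> use neither the history nor the round number, Markov, predetermined and
  constant strategies keep their kind.\<close>

lemma game_le_translation:
  fixes G :: "'m game" and H :: "'k game"
  assumes \<Phi>: "\<And>A. A \<in> moves G \<Longrightarrow> \<Phi> A \<in> moves H"
    and \<psi>: "\<And>A y. A \<in> moves G \<Longrightarrow> y \<in> \<Phi> A \<Longrightarrow> \<psi> y \<in> A"
    and \<psi>_moves: "\<And>y. y \<in> \<Union>(moves H) \<Longrightarrow> \<psi> y \<in> \<Union>(moves G)"
    and pay: "\<And>y. range y \<subseteq> \<Union>(moves H) \<Longrightarrow> y \<in> payoff H \<Longrightarrow> \<psi> \<circ> y \<in> payoff G"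
  shows "H \<le>\<^sub>I\<^sub>I\<^sup>+ G"
proof -
  have pay_run: "\<psi> \<circ> y \<in> payoff G" if "is_run H B y" "y \<in> payoff H" for B y
    using that by (intro pay) (auto simp: is_run_def)
  have run_up: "is_run H (\<lambda>n. \<Phi> (A n)) y"
    if "\<And>n. A n \<in> moves G" "\<And>n. y n \<in> \<Phi> (A n)" for A y
    using that \<Phi> by (auto simp: is_run_def)
  have run_down: "is_run G A (\<psi> \<circ> y)"
    if "\<And>n. A n \<in> moves G" "\<And>n. y n \<in> \<Phi> (A n)" for A y
    using that \<psi> by (auto simp: is_run_def)
  have mark: "II_wins_mark G" if asm: "II_wins_mark H"
  proof -
    obtain \<tau> where \<tau>: "\<And>A n. A \<in> moves H \<Longrightarrow> \<tau> A n \<in> A"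
      and win: "\<And>A x. is_run H A x \<Longrightarrow> (\<And>n. x n = \<tau> (A n) n) \<Longrightarrow> x \<in> payoff H"
      using asm unfolding II_wins_mark_def by blast
    show ?thesis
      unfolding II_wins_mark_def
    proof (intro exI[of _ "\<lambda>A n. \<psi> (\<tau> (\<Phi> A) n)"] conjI ballI allI impI)
      show "\<psi> (\<tau> (\<Phi> A) n) \<in> A" if "A \<in> moves G" for A n
        using that \<psi> \<tau> \<Phi> by blast
      fix A x assume *: "is_run G A x \<and> (\<forall>n. x n = \<psi> (\<tau> (\<Phi> (A n)) n))"
      define y where "y n = \<tau> (\<Phi> (A n)) n" for n
      have "is_run H (\<lambda>n. \<Phi> (A n)) y"
        using * \<tau> \<Phi> by (intro run_up) (auto simp: is_run_def y_def)
      then have "\<psi> \<circ> y \<in> payoff G"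
        using pay_run win y_def by blast
      moreover have "\<psi> \<circ> y = x"
        using * by (auto simp: y_def)
      ultimately show "x \<in> payoff G" by simp
    qed
  qed
  have two: "II_wins G" if asm: "II_wins H"
  proof -
    obtain \<tau> where \<tau>: "\<And>As. As \<in> lists (moves H) \<Longrightarrow> As \<noteq> [] \<Longrightarrow> \<tau> As \<in> last As"
      and win: "\<And>A x. is_run H A x \<Longrightarrow> (\<And>n. x n = \<tau> (map A [0..<Suc n])) \<Longrightarrow> x \<in> payoff H"
      using asm unfolding II_wins_def by blast
    have \<tau>_mem: "\<tau> (map \<Phi> As) \<in> \<Phi> (last As)" if "As \<in> lists (moves G)" "As \<noteq> []" for As
    proof -
      have "map \<Phi> As \<in> lists (moves H)" using that \<Phi> by (auto simp: lists_eq_set)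
      then show ?thesis using \<tau>[of "map \<Phi> As"] that by (simp add: last_map)
    qed
    show ?thesis
      unfolding II_wins_def
    proof (intro exI[of _ "\<lambda>As. \<psi> (\<tau> (map \<Phi> As))"] conjI ballI allI impI)
      show "\<psi> (\<tau> (map \<Phi> As)) \<in> last As" if "As \<in> lists (moves G)" "As \<noteq> []" for As
      proof -
        have "last As \<in> moves G" using that last_in_set[of As] by auto
        then show ?thesis using \<psi> \<tau>_mem[OF that] by blast
      qed
      fix A x assume *: "is_run G A x \<and> (\<forall>n. x n = \<psi> (\<tau> (map \<Phi> (map A [0..<Suc n]))))"
      define y where "y n = \<tau> (map \<Phi> (map A [0..<Suc n]))" for n
      have mv: "A n \<in> moves G" for n using * by (auto simp: is_run_def)
      have "map A [0..<Suc n] \<in> lists (moves G)" for n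
        using mv by (auto simp: lists_eq_set)
      then have "y n \<in> \<Phi> (A n)" for n
        unfolding y_def using \<tau>_mem[of "map A [0..<Suc n]"] by simp
      then have "is_run H (\<lambda>n. \<Phi> (A n)) y"
        using mv by (intro run_up)
      moreover have "y n = \<tau> (map (\<lambda>n. \<Phi> (A n)) [0..<Suc n])" for n
        unfolding y_def by (simp add: comp_def)
      ultimately have "\<psi> \<circ> y \<in> payoff G"
        using pay_run win by blast
      moreover have "\<psi> \<circ> y = x"
        using * by (auto simp: y_def)
      ultimately show "x \<in> payoff G" by simp
    qed
  qed
  have one: "I_wins H" if asm: "I_wins G"
  proof -
    obtain \<sigma> where \<sigma>: "\<And>xs. xs \<in> lists (\<Union>(moves G)) \<Longrightarrow> \<sigma> xs \<in> moves G"
      and win: "\<And>x. is_run G (\<lambda>n. \<sigma> (map x [0..<n])) x \<Longrightarrow> x \<notin> payoff G"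
      using asm unfolding I_wins_iff by blast
    \<comment> \<open>A strategy of P1 has to be legal on all lists of possible answers, not only on
      those arising in a run, so \<open>\<psi>\<close> must respect the full sets of possible
      answers.\<close>
    have \<sigma>_mem: "\<sigma> (map \<psi> ys) \<in> moves G" if ys: "ys \<in> lists (\<Union>(moves H))" for ys
    proof (intro \<sigma> in_listsI ballI)
      fix x assume "x \<in> set (map \<psi> ys)"
      then obtain y where "y \<in> set ys" "x = \<psi> y" by auto
      then show "x \<in> \<Union>(moves G)"
        using ys \<psi>_moves in_listsD by metis
    qed
    show ?thesis
      unfolding I_wins_iff
    proof (intro exI[of _ "\<lambda>ys. \<Phi> (\<sigma> (map \<psi> ys))"] conjI ballI allI impI)
      show "\<Phi> (\<sigma> (map \<psi> ys)) \<in> moves H" if "ys \<in> lists (\<Union>(moves H))" for ys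
        using that by (intro \<Phi> \<sigma>_mem)
      fix y assume run: "is_run H (\<lambda>n. \<Phi> (\<sigma> (map \<psi> (map y [0..<n])))) y"
      define A where "A n = \<sigma> (map \<psi> (map y [0..<n]))" for n
      have "y n \<in> \<Union>(moves H)" for n using run by (auto simp: is_run_def)
      then have "map y [0..<n] \<in> lists (\<Union>(moves H))" for n by (auto simp: lists_eq_set)
      then have "A n \<in> moves G" for n
        unfolding A_def by (rule \<sigma>_mem)
      moreover have "y n \<in> \<Phi> (A n)" for n
        using run unfolding A_def is_run_def by blast
      ultimately have "is_run G A (\<psi> \<circ> y)"
        by (rule run_down)
      then have "\<psi> \<circ> y \<notin> payoff G"
        by (intro win) (simp add: A_def[abs_def])
      then show "y \<notin> payoff H" by (rule contrapos_nn) (rule pay_run[OF run])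
    qed
  qed
  have pre: "I_wins_pre H" if asm: "I_wins_pre G"
  proof -
    obtain \<sigma> where \<sigma>: "\<And>n. \<sigma> n \<in> moves G"
      and win: "\<And>x. is_run G \<sigma> x \<Longrightarrow> x \<notin> payoff G"
      using asm unfolding I_wins_pre_iff by blast
    have "y \<notin> payoff H" if run: "is_run H (\<lambda>n. \<Phi> (\<sigma> n)) y" for y
    proof -
      have "is_run G \<sigma> (\<psi> \<circ> y)"
        using run by (intro run_down \<sigma>) (simp add: is_run_def)
      then have "\<psi> \<circ> y \<notin> payoff G" by (rule win)
      then show ?thesis by (rule contrapos_nn) (rule pay_run[OF run])
    qed
    then show ?thesis
      unfolding I_wins_pre_iff using \<sigma> \<Phi> by (intro exI[of _ "\<lambda>n. \<Phi> (\<sigma> n)"]) simp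
  qed
  have cnst: "I_wins_cnst H" if asm: "I_wins_cnst G"
  proof -
    obtain A0 where A0: "A0 \<in> moves G"
      and win: "\<And>x. is_run G (\<lambda>_. A0) x \<Longrightarrow> x \<notin> payoff G"
      using asm unfolding I_wins_cnst_iff by blast
    have "y \<notin> payoff H" if run: "is_run H (\<lambda>_. \<Phi> A0) y" for y
    proof -
      have "is_run G (\<lambda>_. A0) (\<psi> \<circ> y)"
        using run by (intro run_down A0) (simp add: is_run_def)
      then have "\<psi> \<circ> y \<notin> payoff G" by (rule win)
      then show ?thesis by (rule contrapos_nn) (rule pay_run[OF run])
    qed
    then show ?thesis
      unfolding I_wins_cnst_iff using A0 \<Phi> by (intro bexI[of _ "\<Phi> A0"]) simp_all
  qed
  show ?thesis
    unfolding game_le_def using mark two one pre cnst by blast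
qed

lemma game_le_payoff_mono:
  assumes "moves G = moves H" "payoff G \<subseteq> payoff H"
  shows "G \<le>\<^sub>I\<^sub>I\<^sup>+ H"
  by (rule game_le_translation[where \<Phi> = id and \<psi> = id]) (use assms in auto)

lemma game_le_trans: "G \<le>\<^sub>I\<^sub>I\<^sup>+ H \<Longrightarrow> H \<le>\<^sub>I\<^sub>I\<^sup>+ K \<Longrightarrow> G \<le>\<^sub>I\<^sub>I\<^sup>+ K"
  unfolding game_le_def by blast

section \<open>Concatenating infinitely many finite blocks of rounds\<close>

definition block_start :: "(nat \<Rightarrow> 'b list) \<Rightarrow> nat \<Rightarrow> nat" where
  "block_start L n = length (concat (map L [0..<n]))"

definition block :: "(nat \<Rightarrow> 'b list) \<Rightarrow> nat \<Rightarrow> nat set" where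
  "block L n = {block_start L n..<block_start L (Suc n)}"

lemma block_start_Suc: "block_start L (Suc n) = block_start L n + length (L n)"
  by (simp add: block_start_def)

lemma block_start_mono: "m \<le> n \<Longrightarrow> block_start L m \<le> block_start L n"
  by (rule lift_Suc_mono_le) (simp_all add: block_start_Suc)

lemma disjoint_family_block: "disjoint_family (block L)"
proof -
  have "block L m \<inter> block L n = {}" if "m < n" for m n
    using block_start_mono[of "Suc m" n L] that by (auto simp: block_def)
  then show ?thesis
    unfolding disjoint_family_on_def by (metis Int_commute nat_neq_iff)
qed

lemma block_nonempty: "L n \<noteq> [] \<Longrightarrow> block L n \<noteq> {}"
  by (simp add: block_def block_start_Suc)

lemma finite_block: "finite (block L n)"
  by (simp add: block_def)

lemma image_block: "f ` block L n = (\<lambda>j. f (block_start L n + j)) ` {..<length (L n)}"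
proof -
  have "block L n = (+) (block_start L n) ` {..<length (L n)}"
    unfolding block_def block_start_Suc by (simp add: lessThan_atLeast0 add.commute)
  then show ?thesis by (simp add: image_image)
qed

text \<open>If no list is empty, the first \<open>Suc i\<close> lists together have at least
  \<open>Suc i\<close> entries, so the index \<open>i\<close> is in range. This gives the infinite
  concatenation without searching for the block that contains \<open>i\<close>.\<close>

definition infconcat :: "(nat \<Rightarrow> 'b list) \<Rightarrow> nat \<Rightarrow> 'b" where
  "infconcat L i = concat (map L [0..<Suc i]) ! i"

lemma block_start_ge:
  assumes "\<And>n. L n \<noteq> []"
  shows "n \<le> block_start L n"
proof (induction n)
  case (Suc n)
  have "0 < length (L n)" using assms by simp
  with Suc show ?case unfolding block_start_Suc by linarith
qed simp

lemma concat_upt_append: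
  assumes "m \<le> n"
  shows "concat (map L [0..<n]) = concat (map L [0..<m]) @ concat (map L [m..<n])"
  using upt_add_eq_append[of 0 m "n - m"] assms by simp

lemma concat_eq_infconcat:
  assumes "\<And>n. L n \<noteq> []"
  shows "concat (map L [0..<n]) = map (infconcat L) [0..<block_start L n]"
proof (rule nth_equalityI)
  fix i assume i: "i < length (concat (map L [0..<n]))"
  have "i < length (concat (map L [0..<Suc i]))"
    using block_start_ge[of L "Suc i"] assms unfolding block_start_def by auto
  \<comment> \<open>Whichever of \<open>n\<close> and \<open>Suc i\<close> is smaller, one
    concatenation is a prefix of the other, and \<open>i\<close> is a valid index in both.\<close>
  then have "concat (map L [0..<n]) ! i = concat (map L [0..<Suc i]) ! i"
    using i concat_upt_append[of "Suc i" n L] concat_upt_append[of n "Suc i" L]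
    by (metis linorder_linear nth_append)
  then show "concat (map L [0..<n]) ! i = map (infconcat L) [0..<block_start L n] ! i"
    using i by (simp add: infconcat_def block_start_def)
qed (simp add: block_start_def)

lemma infconcat_nth:
  assumes "\<And>n. L n \<noteq> []" "j < length (L n)"
  shows "infconcat L (block_start L n + j) = L n ! j"
proof -
  have "L n ! j = concat (map L [0..<Suc n]) ! (block_start L n + j)"
    by (simp add: block_start_def)
  also have "\<dots> = infconcat L (block_start L n + j)"
    using assms by (subst concat_eq_infconcat) (simp_all add: block_start_Suc)
  finally show ?thesis by simp
qed

lemma infconcat_in:
  assumes "\<And>n. L n \<noteq> []" "\<And>n. set (L n) \<subseteq> S"
  shows "infconcat L i \<in> S"
proof -
  have "i < length (concat (map L [0..<Suc i]))"
    using block_start_ge[of L "Suc i"] assms(1) unfolding block_start_def by auto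
  then have "infconcat L i \<in> set (concat (map L [0..<Suc i]))"
    unfolding infconcat_def by (rule nth_mem)
  then show ?thesis using assms(2) by auto
qed

section \<open>Replacing one round by a finite block of rounds\<close>

text \<open>A round of \<open>H\<close> against \<open>W\<close> is simulated by rounds of
  \<open>G\<close> against the entries of \<open>dec W\<close>; the points obtained form the answer
  to \<open>W\<close>. \<open>finite_moves\<close> ensures that sets collected this way are
  positions on which strategies of P1 for \<open>H\<close> are defined.
  \<open>payoff_disjoint\<close> admits arbitrary disjoint index sets, not only consecutive blocks,
  because Markov strategies need scattered ones. \<open>payoff_parallel\<close> serves constant
  strategies; its \<open>r\<close> leaves room to skip repeated answers.\<close>

locale block_reduction =
  fixes G :: "'m game" and H :: "'m set game" and dec :: "'m set set \<Rightarrow> 'm set list"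
  assumes dec_nonempty: "W \<in> moves H \<Longrightarrow> dec W \<noteq> []"
    and dec_moves: "W \<in> moves H \<Longrightarrow> set (dec W) \<subseteq> moves G"
    and dec_image: "W \<in> moves H \<Longrightarrow> (\<And>j. j < length (dec W) \<Longrightarrow> x j \<in> dec W ! j) \<Longrightarrow>
      x ` {..<length (dec W)} \<in> W"
    and finite_moves: "finite F \<Longrightarrow> F \<noteq> {} \<Longrightarrow> F \<subseteq> \<Union>(moves G) \<Longrightarrow> F \<in> \<Union>(moves H)"
    and payoff_disjoint: "x \<in> payoff G \<Longrightarrow> range x \<subseteq> \<Union>(moves G) \<Longrightarrow> disjoint_family J \<Longrightarrow>
      (\<And>n. finite (J n)) \<Longrightarrow> (\<And>n. J n \<noteq> {}) \<Longrightarrow> (\<lambda>n. x ` J n) \<in> payoff H"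
    and payoff_parallel: "finite (\<U> :: 'm set set) \<Longrightarrow> \<U> \<noteq> {} \<Longrightarrow>
      (\<And>U. U \<in> \<U> \<Longrightarrow> f U \<in> payoff G) \<Longrightarrow> (\<And>U. U \<in> \<U> \<Longrightarrow> range (f U) \<subseteq> \<Union>(moves G)) \<Longrightarrow>
      \<exists>r :: nat \<Rightarrow> nat. (\<lambda>n. (\<lambda>U. f U (r n)) ` \<U>) \<in> payoff H"
begin

lemma run_in_moves: "is_run G A x \<Longrightarrow> range x \<subseteq> \<Union>(moves G)"
  by (auto simp: is_run_def)

text \<open>A Markov strategy sees only \<open>W\<close> and \<open>n\<close>, so it cannot know how
  many rounds of \<open>G\<close> the earlier blocks took. The \<open>j\<close>-th round of block
  \<open>n\<close> is therefore placed at the number \<open>prod_encode (n, j)\<close>, which is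
  independent of the earlier moves; injectivity of the coding makes the blocks disjoint.\<close>

lemma II_wins_mark_reduction:
  assumes "II_wins_mark G"
  shows "II_wins_mark H"
proof -
  obtain \<tau> where \<tau>: "\<And>A n. A \<in> moves G \<Longrightarrow> \<tau> A n \<in> A"
    and win: "\<And>A x. is_run G A x \<Longrightarrow> (\<And>n. x n = \<tau> (A n) n) \<Longrightarrow> x \<in> payoff G"
    using assms unfolding II_wins_mark_def by blast
  define \<tau>' where
    "\<tau>' W n = (\<lambda>j. \<tau> (dec W ! j) (prod_encode (n, j))) ` {..<length (dec W)}" for W n
  show ?thesis
    unfolding II_wins_mark_def
  proof (intro exI[of _ \<tau>'] conjI ballI allI impI)
    show "\<tau>' W n \<in> W" if "W \<in> moves H" for W n
      unfolding \<tau>'_def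
      using that dec_moves[OF that] \<tau> by (intro dec_image) (auto simp: subset_iff)
    fix W y assume *: "is_run H W y \<and> (\<forall>n. y n = \<tau>' (W n) n)"
    then have W: "W n \<in> moves H" for n by (auto simp: is_run_def)
    \<comment> \<open>The rounds \<open>(n, j)\<close> with \<open>j \<ge> length (dec (W n))\<close> are dummies; they do no harm because
      P2 wins with every selection of finite sets from the rounds of a won run.\<close>
    define A where "A i = (case prod_decode i of (n, j) \<Rightarrow>
      if j < length (dec (W n)) then dec (W n) ! j else hd (dec (W n)))" for i
    define x where "x i = \<tau> (A i) i" for i
    define J where "J n = (\<lambda>j. prod_encode (n, j)) ` {..<length (dec (W n))}" for n
    have A: "A i \<in> moves G" for i
      using dec_moves[OF W] dec_nonempty[OF W]
      by (auto simp: A_def split: prod.split intro: subsetD[OF _ nth_mem] subsetD[OF _ hd_in_set])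
    then have run: "is_run G A x"
      using \<tau> by (auto simp: is_run_def x_def)
    then have "x \<in> payoff G" using win x_def by blast
    then have "(\<lambda>n. x ` J n) \<in> payoff H"
    proof (rule payoff_disjoint)
      show "disjoint_family J"
        by (auto simp: disjoint_family_on_def J_def)
      show "J n \<noteq> {}" for n using dec_nonempty[OF W] by (auto simp: J_def)
    qed (use run_in_moves[OF run] in \<open>auto simp: J_def\<close>)
    moreover have "x ` J n = y n" for n
      using * by (auto simp: J_def \<tau>'_def x_def A_def image_image)
    ultimately show "y \<in> payoff H" by simp
  qed
qed

text \<open>With the whole history at hand, P2 can decompose all earlier moves of P1 and so knows
  the exact position in \<open>G\<close>: all completed blocks, followed by the first
  \<open>j + 1\<close> entries of the current one. Consecutive blocks therefore suffice.\<close>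

lemma II_wins_reduction:
  assumes "II_wins G"
  shows "II_wins H"
proof -
  obtain \<tau> where \<tau>: "\<And>As. As \<in> lists (moves G) \<Longrightarrow> As \<noteq> [] \<Longrightarrow> \<tau> As \<in> last As"
    and win: "\<And>A x. is_run G A x \<Longrightarrow> (\<And>n. x n = \<tau> (map A [0..<Suc n])) \<Longrightarrow> x \<in> payoff G"
    using assms unfolding II_wins_def by blast
  define \<tau>' where "\<tau>' Ws = (\<lambda>j. \<tau> (concat (map dec (butlast Ws)) @ take (Suc j) (dec (last Ws))))
    ` {..<length (dec (last Ws))}" for Ws
  show ?thesis
    unfolding II_wins_def
  proof (intro exI[of _ \<tau>'] conjI ballI allI impI)
    fix Ws assume Ws: "Ws \<in> lists (moves H)" "Ws \<noteq> []"
    then have last: "last Ws \<in> moves H" using last_in_set by auto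
    have but: "set (butlast Ws) \<subseteq> moves H" using Ws in_set_butlastD by fastforce
    show "\<tau>' Ws \<in> last Ws"
      unfolding \<tau>'_def
    proof (rule dec_image[OF last])
      fix j assume j: "j < length (dec (last Ws))"
      let ?As = "concat (map dec (butlast Ws)) @ take (Suc j) (dec (last Ws))"
      have "set ?As \<subseteq> moves G"
        using but dec_moves dec_moves[OF last] set_take_subset[of "Suc j" "dec (last Ws)"] by fastforce
      then have "?As \<in> lists (moves G)" by auto
      moreover have "?As \<noteq> []" "last ?As = dec (last Ws) ! j"
        using j by (auto simp: take_Suc_conv_app_nth)
      ultimately show "\<tau> ?As \<in> dec (last Ws) ! j"
        using \<tau> by metis
    qed
  next
    fix W y assume *: "is_run H W y \<and> (\<forall>n. y n = \<tau>' (map W [0..<Suc n]))"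
    then have W: "W n \<in> moves H" for n by (auto simp: is_run_def)
    define L where "L n = dec (W n)" for n
    have L: "L n \<noteq> []" "set (L n) \<subseteq> moves G" for n
      using dec_nonempty dec_moves W by (auto simp: L_def)
    define A where "A = infconcat L"
    define x where "x i = \<tau> (map A [0..<Suc i])" for i
    have A: "A i \<in> moves G" for i
      unfolding A_def using L by (intro infconcat_in)
    have "map A [0..<Suc i] \<in> lists (moves G)" for i
      using A by (auto simp: lists_eq_set)
    then have "x i \<in> A i" for i
      using \<tau>[of "map A [0..<Suc i]"] by (simp add: x_def)
    with A have run: "is_run G A x" by (auto simp: is_run_def)
    then have "x \<in> payoff G" using win x_def by blast
    then have "(\<lambda>n. x ` block L n) \<in> payoff H"
      using run_in_moves[OF run] block_nonempty[of L, OF L(1)]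
      by (intro payoff_disjoint disjoint_family_block finite_block)
    moreover have "x ` block L n = y n" for n
    proof -
      \<comment> \<open>In the concatenated run, the history up to the \<open>j\<close>-th round of
        block \<open>n\<close> is precisely the list that \<open>\<tau>'\<close> hands to
        \<open>\<tau>\<close>.\<close>
      have "map A [0..<Suc (block_start L n + j)] = concat (map L [0..<n]) @ take (Suc j) (L n)"
        if j: "j < length (L n)" for j
      proof -
        have "map A [0..<Suc (block_start L n + j)]
            = take (block_start L n + Suc j) (concat (map L [0..<Suc n]))"
          using j L(1)
          by (subst concat_eq_infconcat) (simp_all add: A_def block_start_Suc take_map del: upt_Suc)
        then show ?thesis by (simp add: block_start_def)
      qed
      then have "x ` block L n = (\<lambda>j. \<tau> (concat (map L [0..<n]) @ take (Suc j) (L n))) ` {..<length (L n)}"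
        unfolding image_block by (intro image_cong) (simp_all add: x_def)
      then show ?thesis
        using * by (simp add: \<tau>'_def L_def[abs_def] comp_def)
    qed
    ultimately show "y \<in> payoff H" by simp
  qed
qed

text \<open>All moves of P1 in \<open>H\<close> are known in advance, so P1 can play the
  concatenation of their decompositions. If P2 won against it, collecting the answers block by block
  would defeat \<open>\<sigma>\<close>.\<close>

lemma I_wins_pre_reduction:
  assumes "I_wins_pre H"
  shows "I_wins_pre G"
proof -
  obtain \<sigma> where \<sigma>: "\<And>n. \<sigma> n \<in> moves H"
    and win: "\<And>x. is_run H \<sigma> x \<Longrightarrow> x \<notin> payoff H"
    using assms unfolding I_wins_pre_iff by blast
  define L where "L n = dec (\<sigma> n)" for n
  have L: "L n \<noteq> []" "set (L n) \<subseteq> moves G" for n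
    using dec_nonempty dec_moves \<sigma> by (auto simp: L_def)
  have "x \<notin> payoff G" if run: "is_run G (infconcat L) x" for x
  proof
    assume "x \<in> payoff G"
    then have "(\<lambda>n. x ` block L n) \<in> payoff H"
      using run_in_moves[OF run] block_nonempty[of L, OF L(1)]
      by (intro payoff_disjoint disjoint_family_block finite_block)
    moreover have "x ` block L n \<in> \<sigma> n" for n
      unfolding image_block unfolding L_def
    proof (rule dec_image[OF \<sigma>])
      fix j assume "j < length (dec (\<sigma> n))"
      then have "infconcat L (block_start L n + j) = dec (\<sigma> n) ! j"
        using infconcat_nth[of L j n] L(1) by (simp add: L_def)
      then show "x (block_start (\<lambda>n. dec (\<sigma> n)) n + j) \<in> dec (\<sigma> n) ! j"
        using run unfolding is_run_def L_def by metis
    qed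
    ultimately show False
      using win \<sigma> by (auto simp: is_run_def)
  qed
  then show ?thesis
    unfolding I_wins_pre_iff using infconcat_in[of L, OF L] by blast
qed

text \<open>
  The state while P1 imitates a strategy \<open>\<sigma>\<close> for \<open>H\<close> in the game \<open>G\<close>: the completed answers of P2
  in \<open>H\<close>, and the points collected so far towards the current answer.
\<close>

definition step :: "('m set list \<Rightarrow> 'm set set) \<Rightarrow> 'm set list \<times> 'm list \<Rightarrow> 'm \<Rightarrow> 'm set list \<times> 'm list"
  where "step \<sigma> s x = (case s of (Fs, xs) \<Rightarrow>
    if Suc (length xs) < length (dec (\<sigma> Fs)) then (Fs, xs @ [x]) else (Fs @ [set (xs @ [x])], []))"

text \<open>Folding \<open>step\<close> over the points played in \<open>G\<close> recovers the
  simulated position in \<open>H\<close>, and P1 plays the next entry of the current decomposition.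
  A run of \<open>G\<close> won by P2 would then yield, by \<open>payoff_disjoint\<close> applied to
  its blocks, a run of \<open>H\<close> in which P2 beats \<open>\<sigma>\<close>.\<close>

lemma I_wins_reduction:
  assumes "I_wins H"
  shows "I_wins G"
proof -
  obtain \<sigma> where \<sigma>: "\<And>xs. xs \<in> lists (\<Union>(moves H)) \<Longrightarrow> \<sigma> xs \<in> moves H"
    and win: "\<And>x. is_run H (\<lambda>n. \<sigma> (map x [0..<n])) x \<Longrightarrow> x \<notin> payoff H"
    using assms unfolding I_wins_iff by blast
  define state where "state = foldl (step \<sigma>) ([], [])"
  define \<sigma>' where "\<sigma>' xs = (case state xs of (Fs, ys) \<Rightarrow> dec (\<sigma> Fs) ! length ys)" for xs
  \<comment> \<open>The strict bound on \<open>length ys\<close> says that the current block is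
    unfinished, so the entry that \<open>\<sigma>'\<close> plays exists. The invariant covers all
    lists of points, as legality of \<open>\<sigma>'\<close> requires.\<close>
  have inv: "case state xs of (Fs, ys) \<Rightarrow> Fs \<in> lists (\<Union>(moves H)) \<and> length ys < length (dec (\<sigma> Fs))
      \<and> set ys \<subseteq> \<Union>(moves G)" if "xs \<in> lists (\<Union>(moves G))" for xs
    using that
  proof (induction xs rule: rev_induct)
    case Nil
    then show ?case
      using dec_nonempty[OF \<sigma>[of "[]"]] by (simp add: state_def)
  next
    case (snoc x xs)
    obtain Fs ys where s: "state xs = (Fs, ys)" by force
    have Fs: "Fs \<in> lists (\<Union>(moves H))" and ys: "set (ys @ [x]) \<subseteq> \<Union>(moves G)"
      using snoc s by auto
    have "set (ys @ [x]) \<in> \<Union>(moves H)"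
      using ys by (intro finite_moves) auto
    with Fs have Fs': "Fs @ [set (ys @ [x])] \<in> lists (\<Union>(moves H))" by simp
    have "state (xs @ [x]) = step \<sigma> (Fs, ys) x"
      using s by (simp add: state_def)
    then show ?case
      using Fs Fs' ys dec_nonempty[OF \<sigma>[OF Fs']] by (simp add: step_def)
  qed
  have \<sigma>': "\<sigma>' xs \<in> moves G" if xs: "xs \<in> lists (\<Union>(moves G))" for xs
  proof -
    obtain Fs ys where s: "state xs = (Fs, ys)" by force
    then have "Fs \<in> lists (\<Union>(moves H))" and len: "length ys < length (dec (\<sigma> Fs))"
      using inv[OF xs] by simp_all
    then have "set (dec (\<sigma> Fs)) \<subseteq> moves G"
      using dec_moves \<sigma> by blast
    then show ?thesis
      using nth_mem[OF len] s by (auto simp: \<sigma>'_def)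
  qed
  have "x \<notin> payoff G" if run: "is_run G (\<lambda>i. \<sigma>' (map x [0..<i])) x" for x
  proof
    assume pay: "x \<in> payoff G"
    \<comment> \<open>\<open>t n\<close> is the round of \<open>G\<close> in which block
      \<open>n\<close> starts. It cannot be introduced as \<open>block_start L\<close>: the list
      \<open>L n\<close> depends on the state at \<open>t n\<close>, so both arise from one
      recursion, and they are identified afterwards.\<close>
    define t where "t = rec_nat 0
      (\<lambda>_ t. t + length (dec (\<sigma> (fst (state (map x [0..<t]))))))"
    define Fs where "Fs n = fst (state (map x [0..<t n]))" for n
    define L where "L n = dec (\<sigma> (Fs n))" for n
    have t_0: "t 0 = 0" and t_rec: "t (Suc n) = t n + length (L n)" for n
      unfolding L_def Fs_def t_def by (rule rec_nat_0_imp rec_nat_Suc_imp, rule refl)+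
    have t: "t = block_start L"
    proof
      show "t n = block_start L n" for n
      proof (induction n)
        case 0
        show ?case unfolding t_0 by (simp add: block_start_def)
      next
        case (Suc n)
        then show ?case unfolding t_rec block_start_Suc by simp
      qed
    qed
    have x: "x i \<in> \<Union>(moves G)" for i using run_in_moves[OF run] by auto
    have "map x [0..<i] \<in> lists (\<Union>(moves G))" for i
      using x by (auto simp: lists_eq_set)
    then have inv_x: "case state (map x [0..<i]) of (Fs, ys) \<Rightarrow> Fs \<in> lists (\<Union>(moves H))" for i
      using inv[of "map x [0..<i]"] by (simp add: case_prod_beta)
    have Fs_lists: "Fs n \<in> lists (\<Union>(moves H))" for n
      using inv_x[of "t n"] by (simp add: Fs_def case_prod_beta)
    have \<sigma>Fs: "\<sigma> (Fs n) \<in> moves H" for n using \<sigma>[OF Fs_lists] .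
    have L_ne: "L n \<noteq> []" for n
      unfolding L_def using dec_nonempty[OF \<sigma>Fs] .
    have snoc: "state (map x [0..<Suc i]) = step \<sigma> (state (map x [0..<i])) (x i)" for i
      by (simp add: state_def)
    \<comment> \<open>Strictly inside a block only the partial answer grows. The bound on
      \<open>j\<close> is strict because the last point of the block completes the answer and
      empties the buffer.\<close>
    have within: "state (map x [0..<t n + j]) = (Fs n, map x [t n..<t n + j])"
      if "state (map x [0..<t n]) = (Fs n, [])" "j < length (L n)" for n j
      using that(2)
    proof (induction j)
      case 0
      then show ?case using that(1) by simp
    next
      case (Suc j)
      then show ?case
        using snoc[of "t n + j"] by (simp add: step_def L_def)
    qed
    have at_start: "state (map x [0..<t n]) = (map (\<lambda>n. x ` block L n) [0..<n], [])" for n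
    proof (induction n)
      case 0
      then show ?case by (simp add: t_0 state_def)
    next
      case (Suc n)
      \<comment> \<open>The last point of block \<open>n\<close> has index \<open>t n + k\<close>.
        There \<open>step\<close> takes its second branch, which appends the finished set.\<close>
      obtain k where k: "length (L n) = Suc k"
        using L_ne[of n] by (cases "L n") auto
      have Fs: "Fs n = map (\<lambda>n. x ` block L n) [0..<n]" using Suc by (simp add: Fs_def)
      have t_Suc: "t (Suc n) = Suc (t n + k)" unfolding t block_start_Suc k by simp
      have "state (map x [0..<t n + k]) = (Fs n, map x [t n..<t n + k])"
        using within[of n k] Suc Fs k by simp
      then have "state (map x [0..<t (Suc n)]) = (Fs n @ [set (map x [t n..<t n + k] @ [x (t n + k)])], [])"
        unfolding t_Suc snoc using k by (simp add: step_def L_def)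
      moreover have "set (map x [t n..<t n + k] @ [x (t n + k)]) = x ` block L n"
        unfolding block_def t[symmetric] t_Suc by (simp add: atLeastLessThanSuc)
      ultimately show ?case using Fs by simp
    qed
    have Fs: "Fs n = map (\<lambda>n. x ` block L n) [0..<n]" for n
      using at_start by (simp add: Fs_def)
    have "x ` block L n \<in> \<sigma> (Fs n)" for n
      unfolding image_block unfolding L_def
    proof (rule dec_image[OF \<sigma>Fs])
      fix j assume j: "j < length (dec (\<sigma> (Fs n)))"
      have "\<sigma>' (map x [0..<t n + j]) = dec (\<sigma> (Fs n)) ! j"
        using j within[of n j] at_start[of n] Fs[of n] unfolding \<sigma>'_def by (simp add: L_def)
      then show "x (block_start (\<lambda>n. dec (\<sigma> (Fs n))) n + j) \<in> dec (\<sigma> (Fs n)) ! j"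
        using run unfolding is_run_def t L_def by metis
    qed
    then have "is_run H (\<lambda>n. \<sigma> (Fs n)) (\<lambda>n. x ` block L n)"
      using \<sigma>Fs by (auto simp: is_run_def)
    then have "(\<lambda>n. x ` block L n) \<notin> payoff H"
      by (intro win) (simp add: Fs)
    moreover have "(\<lambda>n. x ` block L n) \<in> payoff H"
      using pay run_in_moves[OF run] block_nonempty[of L, OF L_ne]
      by (intro payoff_disjoint disjoint_family_block finite_block)
    ultimately show False by simp
  qed
  then show ?thesis
    unfolding I_wins_iff using \<sigma>' by blast
qed

text \<open>By contraposition, every \<open>U\<close> in \<open>moves G\<close> has a winning
  sequence \<open>f U\<close> of answers to the constant play of \<open>U\<close>. These sequences
  are run in parallel for the finitely many \<open>U\<close> in \<open>dec W\<close>: the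
  \<open>n\<close>-th answer to \<open>W\<close> collects their entries at the common index
  \<open>r n\<close>.\<close>

lemma I_wins_cnst_reduction:
  assumes "I_wins_cnst H"
  shows "I_wins_cnst G"
proof (rule ccontr)
  assume "\<not> I_wins_cnst G"
  then have "\<forall>U\<in>moves G. \<exists>x. (\<forall>n. x n \<in> U) \<and> x \<in> payoff G"
    unfolding I_wins_cnst_iff is_run_def by blast
  then obtain f where f: "\<And>U n. U \<in> moves G \<Longrightarrow> f U n \<in> U" "\<And>U. U \<in> moves G \<Longrightarrow> f U \<in> payoff G"
    by metis
  obtain W where W: "W \<in> moves H" and win: "\<And>y. is_run H (\<lambda>_. W) y \<Longrightarrow> y \<notin> payoff H"
    using assms unfolding I_wins_cnst_iff by blast
  have dec: "dec W \<noteq> []" "set (dec W) \<subseteq> moves G"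
    using dec_nonempty[OF W] dec_moves[OF W] .
  obtain r :: "nat \<Rightarrow> nat" where r: "(\<lambda>n. (\<lambda>U. f U (r n)) ` set (dec W)) \<in> payoff H"
    using payoff_parallel[of "set (dec W)" f] dec f by (auto simp: subset_iff) blast
  have "(\<lambda>U. f U m) ` set (dec W) \<in> W" for m
  proof -
    have "set (dec W) = (!) (dec W) ` {..<length (dec W)}"
      by (auto simp: set_conv_nth)
    then have "(\<lambda>U. f U m) ` set (dec W) = (\<lambda>j. f (dec W ! j) m) ` {..<length (dec W)}"
      by (simp add: image_image)
    also have "\<dots> \<in> W"
      using f dec by (intro dec_image[OF W]) (auto simp: subset_iff)
    finally show ?thesis .
  qed
  then have "is_run H (\<lambda>_. W) (\<lambda>n. (\<lambda>U. f U (r n)) ` set (dec W))"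
    using W by (simp add: is_run_def)
  then show False using win r by blast
qed

lemma game_le_reduction: "G \<le>\<^sub>I\<^sub>I\<^sup>+ H"
  unfolding game_le_def
  using II_wins_mark_reduction II_wins_reduction I_wins_reduction I_wins_pre_reduction
    I_wins_cnst_reduction by blast

end

section \<open>Closed discrete sets in a space and in its Vietoris hyperspace\<close>

lemma Union_nonempty_opens: "\<Union>(nonempty_opens X) = topspace X"
  using openin_subset by (fastforce simp: nonempty_opens_def)

lemma openin_vietoris_basic:
  assumes "finite \<U>" "\<U> \<noteq> {}" "\<U> \<subseteq> nonempty_opens X"
  shows "openin (Pfin X) (vietoris_basic X \<U>)"
  unfolding openin_Pfin
  by (rule arbitrary_union_of_inc) (use assms in \<open>auto simp: is_vietoris_basic_def\<close>)

text \<open>A single local condition at all points of the space combines both requirements: at a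
  point of \<open>A\<close> it expresses discreteness, and at a point outside \<open>A\<close> the
  neighbourhood misses \<open>A\<close>, which expresses closedness.\<close>

lemma CD_iff:
  "A \<in> CD X \<longleftrightarrow> A \<subseteq> topspace X \<and> (\<forall>x\<in>topspace X. \<exists>U. openin X U \<and> x \<in> U \<and> U \<inter> A \<subseteq> {x})"
proof
  assume A: "A \<in> CD X"
  show "A \<subseteq> topspace X \<and> (\<forall>x\<in>topspace X. \<exists>U. openin X U \<and> x \<in> U \<and> U \<inter> A \<subseteq> {x})"
  proof (intro conjI ballI)
    show "A \<subseteq> topspace X" using A closedin_subset by (auto simp: CD_def)
    fix x assume x: "x \<in> topspace X"
    show "\<exists>U. openin X U \<and> x \<in> U \<and> U \<inter> A \<subseteq> {x}"
    proof (cases "x \<in> A")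
      case True
      then obtain U where "openin X U" "U \<inter> A = {x}"
        using A by (auto simp: CD_def nonempty_opens_def)
      then show ?thesis by blast
    next
      case False
      then show ?thesis
        using A x by (intro exI[of _ "topspace X - A"]) (auto simp: CD_def)
    qed
  qed
next
  assume A: "A \<subseteq> topspace X \<and> (\<forall>x\<in>topspace X. \<exists>U. openin X U \<and> x \<in> U \<and> U \<inter> A \<subseteq> {x})"
  have "openin X (topspace X - A)"
  proof (subst openin_subopen, intro ballI)
    fix x assume "x \<in> topspace X - A"
    moreover from this A obtain U where "openin X U" "x \<in> U" "U \<inter> A \<subseteq> {x}" by blast
    ultimately show "\<exists>T. openin X T \<and> x \<in> T \<and> T \<subseteq> topspace X - A"
      using openin_subset by (intro exI[of _ U]) blast
  qed
  then have "closedin X A" using A by (simp add: closedin_def)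
  moreover have "\<exists>U\<in>nonempty_opens X. U \<inter> A = {x}" if "x \<in> A" for x
  proof -
    have "x \<in> topspace X" using A that by blast
    then obtain U where "openin X U" "x \<in> U" "U \<inter> A \<subseteq> {x}" using A by blast
    then show ?thesis
      using that by (intro bexI[of _ U]) (auto simp: nonempty_opens_def)
  qed
  ultimately show "A \<in> CD X" by (simp add: CD_def)
qed

lemma CD_subset: "A \<in> CD X \<Longrightarrow> B \<subseteq> A \<Longrightarrow> B \<in> CD X"
  unfolding CD_iff by (meson Int_mono order_refl order_trans)

text \<open>Intersecting the neighbourhoods given by \<open>CD_iff\<close> handles two sets. The
  closure under finite unions is what lets several winning sequences be combined against a constant
  strategy.\<close>

lemma CD_Union:
  assumes "finite \<A>" "\<A> \<subseteq> CD X"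
  shows "\<Union>\<A> \<in> CD X"
  using assms
proof (induction \<A>)
  case empty
  then show ?case by (auto simp: CD_iff)
next
  case (insert A \<A>)
  then have A: "A \<in> CD X" and B: "\<Union>\<A> \<in> CD X" by auto
  have "\<exists>W. openin X W \<and> x \<in> W \<and> W \<inter> (A \<union> \<Union>\<A>) \<subseteq> {x}" if x: "x \<in> topspace X" for x
  proof -
    obtain U where U: "openin X U" "x \<in> U" "U \<inter> A \<subseteq> {x}"
      using A x unfolding CD_iff by blast
    obtain V where V: "openin X V" "x \<in> V" "V \<inter> \<Union>\<A> \<subseteq> {x}"
      using B x unfolding CD_iff by blast
    show ?thesis
      using U V by (intro exI[of _ "U \<inter> V"]) (auto intro: openin_Int)
  qed
  then have "A \<union> \<Union>\<A> \<in> CD X"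
    using A B unfolding CD_iff by blast
  then show ?case by simp
qed

text \<open>Around the points of \<open>F\<close>, choose open sets \<open>u x\<close> that meet
  \<open>A\<close> at most in \<open>x\<close>. A subset \<open>E\<close> of \<open>A\<close> in the
  Vietoris set of these lies in \<open>F\<close>, because the sets cover \<open>E\<close>, and
  contains \<open>F\<close>, because \<open>E\<close> meets each of them. If some point of
  \<open>F\<close> is outside \<open>A\<close>, its neighbourhood misses \<open>A\<close> and no
  such \<open>E\<close> exists.\<close>

lemma CD_Pfin:
  assumes A: "A \<in> CD X" and \<F>: "\<F> \<subseteq> fin_subsets X" "\<Union>\<F> \<subseteq> A"
  shows "\<F> \<in> CD (Pfin X)"
  unfolding CD_iff topspace_Pfin
proof (intro conjI ballI \<F>)
  fix F assume F: "F \<in> fin_subsets X"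
  then have sub: "F \<subseteq> topspace X" and fin: "finite F" and ne: "F \<noteq> {}"
    by (auto simp: fin_subsets_def)
  have "\<forall>x\<in>F. \<exists>U. openin X U \<and> x \<in> U \<and> U \<inter> A \<subseteq> {x}"
    using A sub unfolding CD_iff by blast
  then obtain u where u: "\<And>x. x \<in> F \<Longrightarrow> openin X (u x)" "\<And>x. x \<in> F \<Longrightarrow> x \<in> u x"
    "\<And>x. x \<in> F \<Longrightarrow> u x \<inter> A \<subseteq> {x}"
    by metis
  have op: "openin (Pfin X) (vietoris_basic X (u ` F))"
    using u fin ne by (intro openin_vietoris_basic) (force simp: nonempty_opens_def)+
  have mem: "F \<in> vietoris_basic X (u ` F)"
    using F u by (auto simp: vietoris_basic_def)
  have "E = F" if E: "E \<in> vietoris_basic X (u ` F)" "E \<in> \<F>" for E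
  proof
    have EA: "E \<subseteq> A" using E \<F> by blast
    have "E \<subseteq> \<Union>(u ` F)" using E by (simp add: vietoris_basic_def)
    then show "E \<subseteq> F" using EA u(3) by blast
    show "F \<subseteq> E"
    proof
      fix x assume x: "x \<in> F"
      then have "E \<inter> u x \<noteq> {}" using E by (auto simp: vietoris_basic_def)
      then show "x \<in> E" using EA u(3)[OF x] by blast
    qed
  qed
  then show "\<exists>U. openin (Pfin X) U \<and> F \<in> U \<and> U \<inter> \<F> \<subseteq> {F}"
    using op mem by blast
qed

lemma SCD_Pfin_I:
  assumes "A \<in> CD X" "\<F> \<subseteq> fin_subsets X" "\<Union>\<F> \<subseteq> A"
  shows "\<F> \<in> SCD_Pfin X"
  using assms CD_Pfin CD_subset by (auto simp: SCD_Pfin_def)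

section \<open>Decomposing Vietoris open sets\<close>

lemma vietoris_list:
  assumes "W \<in> nonempty_opens (Pfin X)"
  obtains Us where "Us \<noteq> []" "set Us \<subseteq> nonempty_opens X" "vietoris_basic X (set Us) \<subseteq> W"
proof -
  obtain F where "F \<in> W" "(arbitrary union_of is_vietoris_basic X) W"
    using assms by (auto simp: nonempty_opens_def openin_Pfin)
  then obtain B where B: "is_vietoris_basic X B" "B \<subseteq> W"
    unfolding union_of_def arbitrary_def by blast
  then obtain \<U> where \<U>: "finite \<U>" "\<U> \<noteq> {}" "\<U> \<subseteq> nonempty_opens X" "B = vietoris_basic X \<U>"
    by (auto simp: is_vietoris_basic_def)
  obtain Us where "set Us = \<U>" using finite_list[OF \<U>(1)] by blast
  then show ?thesis using that[of Us] \<U> B by auto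
qed

text \<open>The choice is fixed once for each \<open>W\<close>, so that it needs no memory and the
  same \<open>W\<close> is decomposed alike in every history. It is a list because the open sets are
  played in order.\<close>

definition vietoris_dec :: "'a topology \<Rightarrow> 'a set set \<Rightarrow> 'a set list" where
  "vietoris_dec X W = (SOME Us. Us \<noteq> [] \<and> set Us \<subseteq> nonempty_opens X \<and> vietoris_basic X (set Us) \<subseteq> W)"

lemma vietoris_dec:
  assumes "W \<in> nonempty_opens (Pfin X)"
  shows "vietoris_dec X W \<noteq> []" "set (vietoris_dec X W) \<subseteq> nonempty_opens X"
    "vietoris_basic X (set (vietoris_dec X W)) \<subseteq> W"
proof -
  have "\<exists>Us. Us \<noteq> [] \<and> set Us \<subseteq> nonempty_opens X \<and> vietoris_basic X (set Us) \<subseteq> W"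
    using vietoris_list[OF assms] by metis
  from someI_ex[OF this] show "vietoris_dec X W \<noteq> []" "set (vietoris_dec X W) \<subseteq> nonempty_opens X"
    "vietoris_basic X (set (vietoris_dec X W)) \<subseteq> W"
    unfolding vietoris_dec_def by auto
qed

lemma image_vietoris_dec:
  assumes W: "W \<in> nonempty_opens (Pfin X)"
    and x: "\<And>j. j < length (vietoris_dec X W) \<Longrightarrow> x j \<in> vietoris_dec X W ! j"
  shows "x ` {..<length (vietoris_dec X W)} \<in> W"
proof -
  let ?Us = "vietoris_dec X W" and ?F = "x ` {..<length (vietoris_dec X W)}"
  note dec = vietoris_dec[OF W]
  have sub: "?F \<subseteq> \<Union>(set ?Us)" using x by fastforce
  also have "\<dots> \<subseteq> topspace X"
    using dec(2) Union_nonempty_opens[of X] by blast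
  finally have "?F \<in> fin_subsets X"
    using dec(1) by (auto simp: fin_subsets_def)
  moreover have "?F \<inter> U \<noteq> {}" if U: "U \<in> set ?Us" for U
  proof -
    obtain j where "j < length ?Us" "?Us ! j = U" using U by (auto simp: in_set_conv_nth)
    then show ?thesis using x[of j] by blast
  qed
  ultimately have "?F \<in> vietoris_basic X (set ?Us)"
    using sub by (simp add: vietoris_basic_def)
  then show ?thesis using dec(3) by blast
qed

text \<open>This isolates what depends on the winning condition: only the two payoff conditions
  remain to be checked, once for the game with sets and once for the game with injective
  sequences.\<close>

lemma vietoris_block_reduction:
  fixes X :: "'a topology"
  assumes G: "moves G = nonempty_opens X" and H: "moves H = nonempty_opens (Pfin X)"
    and "\<And>x J. x \<in> payoff G \<Longrightarrow> range x \<subseteq> topspace X \<Longrightarrow> disjoint_family J \<Longrightarrow>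
      (\<And>n. finite (J n)) \<Longrightarrow> (\<And>n. J n \<noteq> {}) \<Longrightarrow> (\<lambda>n. x ` J n) \<in> payoff H"
    and "\<And>(\<U> :: 'a set set) f. finite \<U> \<Longrightarrow> \<U> \<noteq> {} \<Longrightarrow> (\<And>U. U \<in> \<U> \<Longrightarrow> f U \<in> payoff G) \<Longrightarrow>
      (\<And>U. U \<in> \<U> \<Longrightarrow> range (f U) \<subseteq> topspace X) \<Longrightarrow>
      \<exists>r :: nat \<Rightarrow> nat. (\<lambda>n. (\<lambda>U. f U (r n)) ` \<U>) \<in> payoff H"
  shows "block_reduction G H (vietoris_dec X)"
proof (unfold_locales, unfold G H Union_nonempty_opens, goal_cases)
  case (1 W)
  then show ?case by (rule vietoris_dec)
next
  case (2 W)
  then show ?case by (rule vietoris_dec)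
next
  case (3 W x)
  then show ?case by (rule image_vietoris_dec)
next
  case (4 F)
  then show ?case by (simp add: topspace_Pfin fin_subsets_def)
next
  case (5 x J)
  then show ?case by (rule assms(3))
next
  case (6 \<U> f)
  show ?case by (rule assms(4)[of \<U> f]) (use 6 in auto)
qed

text \<open>Take an injective sequence in the infinite range and choose preimage indices under
  \<open>y\<close>. The resulting \<open>r\<close> need not be increasing; against a constant
  strategy every round offers the same set, so any reindexing is legal.\<close>

lemma inj_subsequence:
  fixes y :: "nat \<Rightarrow> 'b"
  assumes "infinite (range y)"
  obtains r :: "nat \<Rightarrow> nat" where "inj (y \<circ> r)"
proof -
  obtain g :: "nat \<Rightarrow> 'b" where g: "inj g" "range g \<subseteq> range y"
    using infinite_countable_subset[OF assms] by blast
  then have "y (inv y (g n)) = g n" for n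
    by (intro f_inv_into_f) auto
  then have "y \<circ> (inv y \<circ> g) = g" by auto
  then show ?thesis using that[of "inv y \<circ> g"] g by simp
qed

lemma range_image_fin_subsets:
  assumes "range x \<subseteq> topspace X" "\<And>n. finite (J n)" "\<And>n. J n \<noteq> {}"
  shows "range (\<lambda>n. x ` J n) \<subseteq> fin_subsets X"
  using assms by (auto simp: fin_subsets_def)

lemma range_parallel_fin_subsets:
  assumes "finite \<U>" "\<U> \<noteq> {}" "\<And>U. U \<in> \<U> \<Longrightarrow> range (f U) \<subseteq> topspace X"
  shows "range (\<lambda>n. (\<lambda>U. f U (r n)) ` \<U>) \<subseteq> fin_subsets X"
  using assms by (fastforce simp: fin_subsets_def)

section \<open>The comparisons between a space and its hyperspace\<close>

lemma game_le_SCD_Pfin: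
  "G1 (nonempty_opens X) (CD X) \<le>\<^sub>I\<^sub>I\<^sup>+ G1 (nonempty_opens (Pfin X)) (SCD_Pfin X)"
proof (rule block_reduction.game_le_reduction, rule vietoris_block_reduction)
  fix x :: "nat \<Rightarrow> 'a" and J :: "nat \<Rightarrow> nat set"
  assume "x \<in> payoff (G1 (nonempty_opens X) (CD X))" "range x \<subseteq> topspace X"
    "\<And>n. finite (J n)" "\<And>n. J n \<noteq> {}"
  then have "range (\<lambda>n. x ` J n) \<in> SCD_Pfin X"
    by (intro SCD_Pfin_I[of "range x"] range_image_fin_subsets) (auto simp: G1_def)
  then show "(\<lambda>n. x ` J n) \<in> payoff (G1 (nonempty_opens (Pfin X)) (SCD_Pfin X))"
    by (simp add: G1_def)
next
  fix \<U> :: "'a set set" and f :: "'a set \<Rightarrow> nat \<Rightarrow> 'a"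
  assume \<U>: "finite \<U>" "\<U> \<noteq> {}" and pay: "\<And>U. U \<in> \<U> \<Longrightarrow> f U \<in> payoff (G1 (nonempty_opens X) (CD X))"
    and sub: "\<And>U. U \<in> \<U> \<Longrightarrow> range (f U) \<subseteq> topspace X"
  have "(\<Union>U\<in>\<U>. range (f U)) \<in> CD X"
    using \<U> pay by (intro CD_Union) (auto simp: G1_def)
  \<comment> \<open>Repetitions are harmless when only the range counts, so the identity serves as
    \<open>r\<close>.\<close>
  then have "range (\<lambda>n. (\<lambda>U. f U (id n)) ` \<U>) \<in> SCD_Pfin X"
    by (rule SCD_Pfin_I[OF _ range_parallel_fin_subsets[OF \<U> sub]]) auto
  then have "(\<lambda>n. (\<lambda>U. f U (id n)) ` \<U>) \<in> payoff (G1 (nonempty_opens (Pfin X)) (SCD_Pfin X))"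
    by (simp add: G1_def)
  then show "\<exists>r :: nat \<Rightarrow> nat. (\<lambda>n. (\<lambda>U. f U (r n)) ` \<U>)
      \<in> payoff (G1 (nonempty_opens (Pfin X)) (SCD_Pfin X))"
    by blast
qed (simp_all add: G1_def)

text \<open>P2 answers \<open>U\<close> with a point of the answer to the hyperspace set
  \<open>[U]\<close>. These points lie in the union of the played finite sets, which is closed
  discrete by the second condition in \<open>SCD_Pfin\<close>; hence so is the set of the
  points.\<close>

lemma SCD_Pfin_game_le:
  "G1 (nonempty_opens (Pfin X)) (SCD_Pfin X) \<le>\<^sub>I\<^sub>I\<^sup>+ G1 (nonempty_opens X) (CD X)"
proof -
  define \<psi> :: "'a set \<Rightarrow> 'a" where "\<psi> F = (SOME x. x \<in> F)" for F
  have \<psi>: "\<psi> F \<in> F" if "F \<in> fin_subsets X" for F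
    using that by (auto simp: \<psi>_def fin_subsets_def some_in_eq)
  have basic: "vietoris_basic X {U} \<in> nonempty_opens (Pfin X)" if U: "U \<in> nonempty_opens X" for U
  proof -
    obtain x where x: "x \<in> U" using U by (auto simp: nonempty_opens_def)
    then have "x \<in> topspace X" using U openin_subset[of X U] by (auto simp: nonempty_opens_def)
    then have "{x} \<in> vietoris_basic X {U}"
      using x by (auto simp: vietoris_basic_def fin_subsets_def)
    then show ?thesis
      using openin_vietoris_basic[of "{U}" X] U by (auto simp: nonempty_opens_def)
  qed
  show ?thesis
  proof (rule game_le_translation[where \<Phi> = "\<lambda>U. vietoris_basic X {U}" and \<psi> = \<psi>])
    show "\<psi> F \<in> U" if "F \<in> vietoris_basic X {U}" for U F
      using that \<psi> by (auto simp: vietoris_basic_def)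
    show "\<psi> F \<in> \<Union>(moves (G1 (nonempty_opens X) (CD X)))"
      if "F \<in> \<Union>(moves (G1 (nonempty_opens (Pfin X)) (SCD_Pfin X)))" for F
      using that \<psi>[of F] by (auto simp: G1_def Union_nonempty_opens topspace_Pfin fin_subsets_def)
    fix y assume y: "range y \<subseteq> \<Union>(moves (G1 (nonempty_opens (Pfin X)) (SCD_Pfin X)))"
      and pay: "y \<in> payoff (G1 (nonempty_opens (Pfin X)) (SCD_Pfin X))"
    have "range (\<psi> \<circ> y) \<subseteq> \<Union>(range y)"
      using y \<psi> by (auto simp: G1_def Union_nonempty_opens topspace_Pfin)
    moreover have "\<Union>(range y) \<in> CD X"
      using pay by (simp add: G1_def SCD_Pfin_def)
    ultimately show "\<psi> \<circ> y \<in> payoff (G1 (nonempty_opens X) (CD X))"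
      using CD_subset by (auto simp: G1_def)
  qed (use basic in \<open>auto simp: G1_def\<close>)
qed

lemma vecG1_le_Pfin:
  "vecG1 (nonempty_opens X) (CD_seq X) \<le>\<^sub>I\<^sub>I\<^sup>+ vecG1 (nonempty_opens (Pfin X)) (CD_seq (Pfin X))"
proof (rule block_reduction.game_le_reduction, rule vietoris_block_reduction)
  fix x :: "nat \<Rightarrow> 'a" and J :: "nat \<Rightarrow> nat set"
  assume x: "x \<in> payoff (vecG1 (nonempty_opens X) (CD_seq X))" "range x \<subseteq> topspace X"
    and J: "disjoint_family J" "\<And>n. finite (J n)" "\<And>n. J n \<noteq> {}"
  have "range (\<lambda>n. x ` J n) \<in> CD (Pfin X)"
    using x J by (intro CD_Pfin[of "range x"] range_image_fin_subsets) (auto simp: vecG1_def CD_seq_def)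
  \<comment> \<open>As \<open>x\<close> is injective, equal images would come from equal index sets,
    which is impossible for distinct members of a disjoint family of nonempty sets.\<close>
  moreover have "inj (\<lambda>n. x ` J n)"
  proof (rule injI)
    fix m n assume "x ` J m = x ` J n"
    then have "J m = J n"
      using x by (simp add: vecG1_def CD_seq_def inj_image_eq_iff)
    then show "m = n"
      using J by (metis disjoint_family_onD Int_absorb UNIV_I)
  qed
  ultimately show "(\<lambda>n. x ` J n) \<in> payoff (vecG1 (nonempty_opens (Pfin X)) (CD_seq (Pfin X)))"
    by (simp add: vecG1_def CD_seq_def)
next
  fix \<U> :: "'a set set" and f :: "'a set \<Rightarrow> nat \<Rightarrow> 'a"
  assume \<U>: "finite \<U>" "\<U> \<noteq> {}"
    and pay: "\<And>U. U \<in> \<U> \<Longrightarrow> f U \<in> payoff (vecG1 (nonempty_opens X) (CD_seq X))"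
    and sub: "\<And>U. U \<in> \<U> \<Longrightarrow> range (f U) \<subseteq> topspace X"
  let ?y = "\<lambda>n. (\<lambda>U. f U n) ` \<U>"
  \<comment> \<open>Although each \<open>f U\<close> is injective, the collected sets may repeat,
    for instance when two sequences swap values. But finitely many finite sets cannot cover the
    infinite range of one \<open>f U\<close>, so infinitely many distinct answers occur and
    \<open>r\<close> can select them.\<close>
  have "infinite (range ?y)"
  proof
    assume "finite (range ?y)"
    then have fin: "finite (\<Union>(range ?y))" using \<U> by auto
    obtain U where U: "U \<in> \<U>" using \<U> by blast
    then have "range (f U) \<subseteq> \<Union>(range ?y)" by auto
    moreover have "infinite (range (f U))"
      using pay[OF U] by (auto simp: vecG1_def CD_seq_def finite_image_iff)
    ultimately show False using fin finite_subset by blast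
  qed
  then obtain r :: "nat \<Rightarrow> nat" where r: "inj (?y \<circ> r)" by (rule inj_subsequence)
  have "(\<Union>U\<in>\<U>. range (f U)) \<in> CD X"
    using \<U> pay by (intro CD_Union) (auto simp: vecG1_def CD_seq_def)
  then have "range (\<lambda>n. (\<lambda>U. f U (r n)) ` \<U>) \<in> CD (Pfin X)"
    by (rule CD_Pfin[OF _ range_parallel_fin_subsets[OF \<U> sub]]) auto
  with r show "\<exists>r :: nat \<Rightarrow> nat. (\<lambda>n. (\<lambda>U. f U (r n)) ` \<U>)
      \<in> payoff (vecG1 (nonempty_opens (Pfin X)) (CD_seq (Pfin X)))"
    by (intro exI[of _ r]) (simp add: vecG1_def CD_seq_def comp_def)
qed (simp_all add: vecG1_def)

theorem theorem3p18:
  fixes X :: "'a topology"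
  assumes "topspace X \<noteq> {}"
  shows "G1 (nonempty_opens X) (CD X) \<rightleftharpoons> G1 (nonempty_opens (Pfin X)) (SCD_Pfin X)
    \<and> G1 (nonempty_opens X) (CD X) \<le>\<^sub>I\<^sub>I\<^sup>+ G1 (nonempty_opens (Pfin X)) (CD (Pfin X))
    \<and> vecG1 (nonempty_opens X) (CD_seq X) \<le>\<^sub>I\<^sub>I\<^sup>+ vecG1 (nonempty_opens (Pfin X)) (CD_seq (Pfin X))"
proof (intro conjI vecG1_le_Pfin)
  show "G1 (nonempty_opens X) (CD X) \<rightleftharpoons> G1 (nonempty_opens (Pfin X)) (SCD_Pfin X)"
    by (simp add: game_equiv_def game_le_SCD_Pfin SCD_Pfin_game_le)
  \<comment> \<open>Dropping the condition on the union only enlarges the set of plays won by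
    P2.\<close>
  have "G1 (nonempty_opens (Pfin X)) (SCD_Pfin X) \<le>\<^sub>I\<^sub>I\<^sup>+ G1 (nonempty_opens (Pfin X)) (CD (Pfin X))"
    by (rule game_le_payoff_mono) (auto simp: G1_def SCD_Pfin_def)
  with game_le_SCD_Pfin
  show "G1 (nonempty_opens X) (CD X) \<le>\<^sub>I\<^sub>I\<^sup>+ G1 (nonempty_opens (Pfin X)) (CD (Pfin X))"
    by (rule game_le_trans)
qed

end
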